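(* Let $f,c,g$ satisfy the standing assumptions, let $\mu\in(0,\gamma_g)$ and $\hat y\in\mathbb{R}^m$ be fixed, and let $F,P,p,\mathbf{O}$ be as in the context. Consider a sequence of iterates $\{(x^j,z^j)\}_{j\in\mathbb{N}}$ generated by the nonmonotone descent method with an oracle (described in the context) with $\varepsilon>0$. Suppose that the sequence $\{x^j\}_{j\in\mathbb{N}}$, if infinite, admits an accumulation point. Then, in finitely many steps, the method returns an $\varepsilon$-$\Upsilon$-stationary point $x^\ast\in\operatorname{dom}p$ for $p$ with certificate $z^\ast\in\mathbf{O}(x^\ast)$.
   Context: Write $\overline{\mathbb{R}}=\mathbb{R}\cup\{\infty\}$. Standing assumptions: $f:\mathbb{R}^n\to\mathbb{R}$ and $c:\mathbb{R}^n\to\mathbb{R}^m$ are continuously differentiable; $g:\mathbb{R}^m\to\overline{\mathbb{R}}$ is proper, lower semicontinuous and prox-bounded (i.e. $g+\|\cdot\|^2/(2\gamma)$ is bounded below for some $\gamma>0$; the supremum of such $\gamma$ is the threshold $\gamma_g\in(0,\infty]$); $\inf_x\{f(x)+g(c(x))\}\in\mathbb{R}$. For fixed $\mu\in(0,\gamma_g)$ and $\hat y\in\mathbb{R}^m$ define $F(x,z):=f(x)+\frac1{2\mu}\|c(x)+\mu\hat y-z\|^2$, $\ P(x,z):=F(x,z)+g(z)$, $\ p(x):=\inf_{z\in\mathbb{R}^m}P(x,z)$, $\ \mathbf{O}(x):=\operatorname{argmin}_{z\in\mathbb{R}^m}P(x,z)$. A point $x^\ast\in\operatorname{dom}p$ is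 $\varepsilon$-$\Upsilon$-stationary for $p$ with certificate $z^\ast\in\mathbf{O}(x^\ast)$ if there is $v\in\mathbb{R}^n$ with $\|v\|\le\varepsilon$ and $(v,0)\in\partial P(x^\ast,z^\ast)$, where $\partial$ is the limiting (Mordukhovich) subdifferential. Nonmonotone descent method with an oracle: given $x^0\in\mathbb{R}^n$ and $\varepsilon\ge0$, select parameters $\alpha,\beta,\theta\in(0,1)$, $\omega,\nu\in(0,1]$ and set $\Phi_0:=p(x^0)$. For $j=0,1,2,\dots$: (1) select any $z^j\in\mathbf{O}(x^j)$ and set $\nabla p^j:=\nabla_xF(x^j,z^j)$; (2) if $\|\nabla p^j\|\le\varepsilon$, stop and return $(x^\ast,z^\ast):=(x^j,z^j)$; (3) compute any $d^j\in\mathbb{R}^n$ with $\langle\nabla p^j,d^j\rangle\le-\theta\|\nabla p^j\|\|d^j\|$ and $\|d^j\|\ge\omega\|\nabla p^j\|$; (4) compute (by backtracking over $\ell_j=0,1,2,\dots$) the largest $\gamma_j=\beta^{\ell_j}$, $\ell_j\in\mathbb{N}$, and a point $x^{j+1}\in\mathbb{R}^n$ such that $p(x^{j+1})\le p(x^j+\gamma_jd^j)\le\Phi_j+\alpha\gamma_j\langle\nabla p^j,d^j\rangle$; (5) set $\Phi_{j+1}:=(1-\nu)\Phi_j+\nu\,p(x^{j+1})$. *)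

theory Defs
  imports "HOL-Analysis.Analysis" "HOL-Library.Extended_Nat"
begin

section \<open>Variational analysis of extended-real-valued functions\<close>

definition continuously_differentiable ::
    "('a::real_normed_vector \<Rightarrow> 'b::real_normed_vector) \<Rightarrow> bool" where
  "continuously_differentiable h \<longleftrightarrow>
     (\<exists>h'. (\<forall>x. (h has_derivative blinfun_apply (h' x)) (at x)) \<and> continuous_on UNIV h')"

definition grad :: "('a::real_inner \<Rightarrow> real) \<Rightarrow> 'a \<Rightarrow> 'a" where
  "grad h x = (THE D. GDERIV h x :> D)"

text \<open>Functions into $\mathbb{R} \cup \{\infty\}$ are rendered as functions into \<^typ>\<open>ereal\<close>;
  properness excludes the value \<^term>\<open>-\<infinity> :: ereal\<close>.\<close>

definition effective_dom :: "('a \<Rightarrow> ereal) \<Rightarrow> 'a set" where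
  "effective_dom h = {x. h x < \<infinity>}"

definition proper :: "('a \<Rightarrow> ereal) \<Rightarrow> bool" where
  "proper h \<longleftrightarrow> (\<forall>x. h x \<noteq> -\<infinity>) \<and> effective_dom h \<noteq> {}"

definition lower_semicontinuous :: "('a::topological_space \<Rightarrow> ereal) \<Rightarrow> bool" where
  "lower_semicontinuous h \<longleftrightarrow> (\<forall>x. h x \<le> Liminf (at x) h)"

definition prox_parameters :: "('a::real_normed_vector \<Rightarrow> ereal) \<Rightarrow> real set" where
  "prox_parameters h =
     {\<gamma>. 0 < \<gamma> \<and> (\<exists>M::real. \<forall>z. ereal M \<le> h z + ereal ((norm z)\<^sup>2 / (2 * \<gamma>)))}"

definition prox_bounded :: "('a::real_normed_vector \<Rightarrow> ereal) \<Rightarrow> bool" where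
  "prox_bounded h \<longleftrightarrow> prox_parameters h \<noteq> {}"

definition prox_threshold :: "('a::real_normed_vector \<Rightarrow> ereal) \<Rightarrow> ereal" where
  "prox_threshold h = Sup (ereal ` prox_parameters h)"

definition regular_subdifferential :: "('a::real_inner \<Rightarrow> ereal) \<Rightarrow> 'a \<Rightarrow> 'a set" where
  "regular_subdifferential h x =
     {v. \<bar>h x\<bar> \<noteq> \<infinity> \<and>
         0 \<le> Liminf (at x) (\<lambda>y. (h y - h x - ereal (v \<bullet> (y - x))) / ereal (norm (y - x)))}"

definition limiting_subdifferential :: "('a::real_inner \<Rightarrow> ereal) \<Rightarrow> 'a \<Rightarrow> 'a set" where
  "limiting_subdifferential h x =
     {v. \<bar>h x\<bar> \<noteq> \<infinity> \<and>
         (\<exists>xs vs. xs \<longlonglongrightarrow> x \<and> (\<lambda>k. h (xs k)) \<longlonglongrightarrow> h x \<and> vs \<longlonglongrightarrow> v \<and>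
                  (\<forall>k. vs k \<in> regular_subdifferential h (xs k)))}"

section \<open>Parametric minimization\<close>

definition marginal :: "('a \<times> 'b \<Rightarrow> ereal) \<Rightarrow> 'a \<Rightarrow> ereal" where
  "marginal P x = (INF z. P (x, z))"

definition oracle_set :: "('a \<times> 'b \<Rightarrow> ereal) \<Rightarrow> 'a \<Rightarrow> 'b set" where
  "oracle_set P x = {z. is_arg_min (\<lambda>z. P (x, z)) (\<lambda>_. True) z}"

definition upsilon_stationary ::
    "('a::real_inner \<times> 'b::real_inner \<Rightarrow> ereal) \<Rightarrow> real \<Rightarrow> 'a \<Rightarrow> 'b \<Rightarrow> bool" where
  "upsilon_stationary P \<epsilon> x z \<longleftrightarrow>
     x \<in> effective_dom (marginal P) \<and> z \<in> oracle_set P x \<and>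
     (\<exists>v. norm v \<le> \<epsilon> \<and> (v, 0) \<in> limiting_subdifferential P (x, z))"

definition smooth_part ::
    "('a \<Rightarrow> real) \<Rightarrow> ('a \<Rightarrow> 'b::real_normed_vector) \<Rightarrow> real \<Rightarrow> 'b \<Rightarrow> 'a \<Rightarrow> 'b \<Rightarrow> real" where
  "smooth_part f c \<mu> y x z = f x + 1 / (2 * \<mu>) * (norm (c x + \<mu> *\<^sub>R y - z))\<^sup>2"

definition penalty ::
    "('a \<Rightarrow> real) \<Rightarrow> ('a \<Rightarrow> 'b::real_normed_vector) \<Rightarrow> ('b \<Rightarrow> ereal) \<Rightarrow> real \<Rightarrow> 'b \<Rightarrow> 'a \<times> 'b \<Rightarrow> ereal" where
  "penalty f c g \<mu> y = (\<lambda>(x, z). ereal (smooth_part f c \<mu> y x z) + g z)"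

section \<open>The nonmonotone descent method with an oracle\<close>

text \<open>The method sees the problem only through the merit function \<open>p\<close>, the oracle \<open>Orc\<close> and
  the map \<open>G\<close> with $G\,x\,z = \nabla_x F(x,z)$. The argument \<open>v\<close> below is the
  vector $\nabla p^j$ and \<open>\<phi>\<close> is the value $\Phi_j$.\<close>

definition admissible_direction ::
    "real \<Rightarrow> real \<Rightarrow> 'a::real_inner \<Rightarrow> 'a \<Rightarrow> bool" where
  "admissible_direction \<theta> \<omega> v d \<longleftrightarrow>
     v \<bullet> d \<le> - \<theta> * norm v * norm d \<and> norm d \<ge> \<omega> * norm v"

definition acceptable_step ::
    "('a::real_inner \<Rightarrow> ereal) \<Rightarrow> real \<Rightarrow> ereal \<Rightarrow> 'a \<Rightarrow> 'a \<Rightarrow> 'a \<Rightarrow> real \<Rightarrow> 'a \<Rightarrow> bool" where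
  "acceptable_step p \<alpha> \<phi> x v d \<gamma> x' \<longleftrightarrow>
     p x' \<le> p (x + \<gamma> *\<^sub>R d) \<and> p (x + \<gamma> *\<^sub>R d) \<le> \<phi> + ereal (\<alpha> * \<gamma> * (v \<bullet> d))"

definition returns_at ::
    "('a::real_inner \<Rightarrow> 'b set) \<Rightarrow> ('a \<Rightarrow> 'b \<Rightarrow> 'a) \<Rightarrow> real \<Rightarrow> 'a \<Rightarrow> 'b \<Rightarrow> bool" where
  "returns_at Orc G \<epsilon> x z \<longleftrightarrow> z \<in> Orc x \<and> norm (G x z) \<le> \<epsilon>"

text \<open>A full iteration from \<open>x\<close> to \<open>x'\<close>; since $0 < \beta < 1$, the largest step size
  $\beta^\ell$ is the one with the least exponent.\<close>

definition iteration ::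
    "('a::real_inner \<Rightarrow> ereal) \<Rightarrow> ('a \<Rightarrow> 'b set) \<Rightarrow> ('a \<Rightarrow> 'b \<Rightarrow> 'a) \<Rightarrow>
     real \<Rightarrow> real \<Rightarrow> real \<Rightarrow> real \<Rightarrow> real \<Rightarrow> real \<Rightarrow>
     'a \<Rightarrow> 'b \<Rightarrow> 'a \<Rightarrow> nat \<Rightarrow> ereal \<Rightarrow> 'a \<Rightarrow> ereal \<Rightarrow> bool" where
  "iteration p Orc G \<epsilon> \<alpha> \<beta> \<theta> \<omega> \<nu> x z d \<l> \<phi> x' \<phi>' \<longleftrightarrow>
     z \<in> Orc x \<and>
     \<not> norm (G x z) \<le> \<epsilon> \<and>
     admissible_direction \<theta> \<omega> (G x z) d \<and>
     acceptable_step p \<alpha> \<phi> x (G x z) d (\<beta> ^ \<l>) x' \<and>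
     (\<forall>i<\<l>. \<nexists>x''. acceptable_step p \<alpha> \<phi> x (G x z) d (\<beta> ^ i) x'') \<and>
     \<phi>' = ereal (1 - \<nu>) * \<phi> + ereal \<nu> * p x'"

text \<open>The method breaks down at \<open>x\<close> if the oracle has no point to offer, no direction is
  admissible, or the backtracking from the chosen direction \<open>d\<close> never ends.\<close>

definition breaks_down ::
    "('a::real_inner \<Rightarrow> ereal) \<Rightarrow> ('a \<Rightarrow> 'b set) \<Rightarrow> ('a \<Rightarrow> 'b \<Rightarrow> 'a) \<Rightarrow>
     real \<Rightarrow> real \<Rightarrow> real \<Rightarrow> real \<Rightarrow> real \<Rightarrow> 'a \<Rightarrow> 'b \<Rightarrow> 'a \<Rightarrow> ereal \<Rightarrow> bool" where
  "breaks_down p Orc G \<epsilon> \<alpha> \<beta> \<theta> \<omega> x z d \<phi> \<longleftrightarrow>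
     Orc x = {} \<or>
     (z \<in> Orc x \<and> \<not> norm (G x z) \<le> \<epsilon> \<and>
      ((\<nexists>d'. admissible_direction \<theta> \<omega> (G x z) d') \<or>
       (admissible_direction \<theta> \<omega> (G x z) d \<and>
        (\<nexists>\<l> x'. acceptable_step p \<alpha> \<phi> x (G x z) d (\<beta> ^ \<l>) x'))))"

text \<open>A complete run consists of the iterates with index up to \<open>N\<close>, where
  \<open>N = \<infinity>\<close> means that the method never stops. Entries of the sequences with an index beyond
  \<open>N\<close> are meaningless. A finite run is allowed to end in a breakdown, so that its end
  being a return of the method is a claim and not part of this definition.\<close>

definition descent_run ::
    "('a::real_inner \<Rightarrow> ereal) \<Rightarrow> ('a \<Rightarrow> 'b set) \<Rightarrow> ('a \<Rightarrow> 'b \<Rightarrow> 'a) \<Rightarrow>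
     real \<Rightarrow> real \<Rightarrow> real \<Rightarrow> real \<Rightarrow> real \<Rightarrow> real \<Rightarrow> enat \<Rightarrow>
     (nat \<Rightarrow> 'a) \<Rightarrow> (nat \<Rightarrow> 'b) \<Rightarrow> (nat \<Rightarrow> 'a) \<Rightarrow> (nat \<Rightarrow> nat) \<Rightarrow> (nat \<Rightarrow> ereal) \<Rightarrow> bool" where
  "descent_run p Orc G \<epsilon> \<alpha> \<beta> \<theta> \<omega> \<nu> N x z d \<l> \<Phi> \<longleftrightarrow>
     \<Phi> 0 = p (x 0) \<and>
     (\<forall>j. enat j < N \<longrightarrow>
        iteration p Orc G \<epsilon> \<alpha> \<beta> \<theta> \<omega> \<nu> (x j) (z j) (d j) (\<l> j) (\<Phi> j) (x (Suc j)) (\<Phi> (Suc j))) \<and>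
     (\<forall>J. N = enat J \<longrightarrow>
        returns_at Orc G \<epsilon> (x J) (z J) \<or>
        breaks_down p Orc G \<epsilon> \<alpha> \<beta> \<theta> \<omega> (x J) (z J) (d J) (\<Phi> J))"

definition accumulation_point :: "(nat \<Rightarrow> 'a::topological_space) \<Rightarrow> 'a \<Rightarrow> bool" where
  "accumulation_point x a \<longleftrightarrow> (\<exists>r. strict_mono r \<and> (x \<circ> r) \<longlonglongrightarrow> a)"

end

theory Submission
  imports Defs
begin

text \<open>
  The marginal function \<open>p\<close> is nonsmooth, but it is majorized by smooth functions: if \<open>z\<close> is a
  minimizer for \<open>u\<close>, then $p(w) \le P(w,z) = p(u) + F(w,z) - F(u,z)$ for all \<open>w\<close>
  (\<open>marginal_majorized\<close>). So $\nabla_x F(u,z)$ serves as a gradient of \<open>p\<close> in upper estimates, and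
  the acceptance test of the line search asks for nothing but an upper estimate.

  Because \<open>\<mu>\<close> lies below the threshold of prox-boundedness, \<open>P(u, \<cdot>)\<close> grows quadratically, uniformly
  for \<open>u\<close> in a compact set (\<open>penalty_coercive\<close>). Hence minimizers exist, they stay bounded as long as
  \<open>u\<close> does, and \<open>p\<close> is real-valued and locally bounded below.

  A finite run cannot end in a breakdown: minimizers exist, the negative gradient is an admissible
  direction, and the majorization together with $0 < \alpha < 1$ makes every sufficiently short
  step acceptable (\<open>no_breakdown\<close>). At a returned point the minimality of \<open>z\<close> even puts
  $(\nabla_x F(x,z), 0)$ into the regular subdifferential of \<open>P\<close>
  (\<open>gradient_in_regular_subdifferential\<close>).

  It remains to exclude an infinite run with an accumulation point \<open>a\<close>
  (\<open>infinite_run_no_accumulation\<close>). All gradients along it are longer than \<open>\<epsilon>\<close>, so every iteration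
  lowers the averaged merit value by at least a fixed multiple of the step length $\gamma_j\|d_j\|$
  (\<open>iteration_decrease\<close>). The merit values decrease and dominate \<open>p\<close> at the iterates, infinitely many of
  which are near \<open>a\<close>, so they are bounded below; therefore $\gamma_j\|d_j\| \to 0$. As $\|d_j\|$ is bounded away from zero,
  eventually $\gamma_j < 1$, so the step $\gamma_j/\beta$ was rejected. Along the subsequence that
  converges to \<open>a\<close> both ends of the rejected step tend to \<open>a\<close> while the oracle points stay bounded, and
  there the first-order expansion of \<open>F\<close> is accurate up to any prescribed multiple of the step length
  (\<open>F_linearization_uniform\<close>). So the rejected step would have been acceptable, a contradiction.
\<close>

section \<open>Smooth functions\<close>

text \<open>
  The expansion is based at a moving point \<open>u\<close>, not at \<open>a\<close>: the rejected steps of the method join two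
  points both of which vary while they approach \<open>a\<close>. Continuity of the derivative is what makes the
  remainder uniform.
\<close>

lemma C1_strictly_differentiable:
  fixes h :: "'a::real_normed_vector \<Rightarrow> 'b::real_normed_vector"
  assumes "continuously_differentiable h" and "0 < e"
  obtains \<delta> where "0 < \<delta>"
    and "\<And>u w D. \<lbrakk>u \<in> ball a \<delta>; w \<in> ball a \<delta>; (h has_derivative D) (at u)\<rbrakk>
           \<Longrightarrow> norm (h w - h u - D (w - u)) \<le> e * norm (w - u)"
proof -
  obtain h' where h': "\<And>x. (h has_derivative blinfun_apply (h' x)) (at x)"
    and cont: "continuous_on UNIV h'"
    using assms(1) unfolding continuously_differentiable_def by auto
  have "isCont h' a"
    using cont by (simp add: continuous_on_eq_continuous_at)
  then obtain \<delta> where "0 < \<delta>" and \<delta>: "\<And>x. dist x a < \<delta> \<Longrightarrow> dist (h' x) (h' a) < e / 2"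
    using \<open>0 < e\<close> unfolding continuous_at_eps_delta by (meson half_gt_zero)
  show thesis
  proof
    fix u w D
    assume u: "u \<in> ball a \<delta>" and w: "w \<in> ball a \<delta>" and D: "(h has_derivative D) (at u)"
    have "D = blinfun_apply (h' u)"
      using has_derivative_unique D h' by blast
    moreover have "norm (h w - h u - h' u (w - u)) \<le> norm (w - u) * e"
    proof (rule differentiable_bound_linearization[where S = "ball a \<delta>" and f' = "\<lambda>x. blinfun_apply (h' x)"])
      show "u + t *\<^sub>R (w - u) \<in> ball a \<delta>" if "t \<in> {0..1}" for t
        using convexD_alt[OF convex_ball u w, of t] that by (simp add: algebra_simps)
      show "(h has_derivative blinfun_apply (h' x)) (at x within ball a \<delta>)" for x
        using h' has_derivative_at_withinI by blast
      show "onorm (blinfun_apply (h' x) - blinfun_apply (h' u)) \<le> e" if "x \<in> ball a \<delta>" for x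
      proof -
        have "blinfun_apply (h' x) - blinfun_apply (h' u) = blinfun_apply (h' x - h' u)"
          by (auto simp: fun_eq_iff blinfun.diff_left)
        moreover have "dist (h' x) (h' u) < e"
          using dist_triangle_half_l[of "h' x" "h' a" e "h' u"] \<delta>[of x] \<delta>[of u] that u
          by (simp add: dist_commute)
        ultimately show ?thesis
          by (simp add: dist_norm norm_blinfun.rep_eq)
      qed
    qed (use u in auto)
    ultimately show "norm (h w - h u - D (w - u)) \<le> e * norm (w - u)"
      by (simp add: mult.commute)
  qed fact
qed

lemma C1_differentiable:
  assumes "continuously_differentiable h"
  obtains D where "(h has_derivative D) (at u)"
  using assms unfolding continuously_differentiable_def by blast

lemma C1_continuous_on:
  assumes "continuously_differentiable h"
  shows "continuous_on S h"
  using assms unfolding continuously_differentiable_def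
  by (metis continuous_at_imp_continuous_on has_derivative_continuous)

text \<open>
  The gradient is introduced by a definite description; in finite dimension the Riesz representation
  of the derivative, here by its adjoint, shows that the description is always met.
\<close>

lemma has_derivative_grad:
  fixes h :: "'a::euclidean_space \<Rightarrow> real"
  assumes "(h has_derivative D) (at x)"
  shows "D = (\<lambda>v. grad h x \<bullet> v)"
proof -
  have lin: "linear D"
    using assms has_derivative_linear by blast
  have eq: "D = (\<lambda>v. v \<bullet> adjoint D 1)"
    using adjoint_works[OF lin, of _ 1] by simp
  have "grad h x = adjoint D 1"
    unfolding grad_def gderiv_def
  proof (rule the_equality)
    show "(h has_derivative (\<lambda>v. v \<bullet> adjoint D 1)) (at x)"
      using assms eq by simp
    fix E assume "(h has_derivative (\<lambda>v. v \<bullet> E)) (at x)"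
    then have "(\<lambda>v. v \<bullet> E) = D"
      using assms has_derivative_unique by blast
    then show "E = adjoint D 1"
      by (metis eq vector_eq_ldot)
  qed
  then show ?thesis
    using eq by (simp add: inner_commute)
qed

lemma C1_norm_square:
  fixes h :: "'a::real_normed_vector \<Rightarrow> 'b::real_inner"
  assumes "continuously_differentiable h"
  shows "continuously_differentiable (\<lambda>u. (norm (h u + b))\<^sup>2)"
proof -
  obtain h' where h': "\<And>x. (h has_derivative blinfun_apply (h' x)) (at x)"
    and cont: "continuous_on UNIV h'"
    using assms(1) unfolding continuously_differentiable_def by auto
  have hc: "continuous_on UNIV h"
    using assms by (rule C1_continuous_on)
  show ?thesis
    unfolding continuously_differentiable_def power2_norm_eq_inner
  proof (intro exI conjI allI)
    show "((\<lambda>u. (h u + b) \<bullet> (h u + b)) has_derivative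
            blinfun_apply (2 *\<^sub>R (blinfun_inner_right (h x + b) o\<^sub>L h' x))) (at x)" for x
      by (rule derivative_eq_intros h' | simp)+
        (auto simp: fun_eq_iff blinfun.bilinear_simps inner_commute)
    show "continuous_on UNIV (\<lambda>x. 2 *\<^sub>R (blinfun_inner_right (h x + b) o\<^sub>L h' x))"
      by (intro continuous_intros hc cont)
  qed
qed

lemma C1_add_scaled:
  fixes h k :: "'a::real_normed_vector \<Rightarrow> 'b::real_normed_vector"
  assumes "continuously_differentiable h" and "continuously_differentiable k"
  shows "continuously_differentiable (\<lambda>u. h u + r *\<^sub>R k u)"
proof -
  obtain h' k' where "\<And>x. (h has_derivative blinfun_apply (h' x)) (at x)" "continuous_on UNIV h'"
      "\<And>x. (k has_derivative blinfun_apply (k' x)) (at x)" "continuous_on UNIV k'"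
    using assms unfolding continuously_differentiable_def by auto
  then show ?thesis
    unfolding continuously_differentiable_def
    by (intro exI[of _ "\<lambda>x. h' x + r *\<^sub>R k' x"])
      (auto simp: blinfun.bilinear_simps intro!: derivative_eq_intros continuous_intros)
qed

section \<open>The penalized composite objective\<close>

locale penalized_composite =
  fixes f :: "'a::euclidean_space \<Rightarrow> real"
    and c :: "'a \<Rightarrow> 'b::euclidean_space"
    and g :: "'b \<Rightarrow> ereal"
    and \<mu> :: real
    and yhat :: 'b
  assumes f_C1: "continuously_differentiable f"
    and c_C1: "continuously_differentiable c"
    and g_proper: "proper g"
    and g_lsc: "lower_semicontinuous g"
    and \<mu>_pos: "0 < \<mu>"
    and \<mu>_threshold: "ereal \<mu> < prox_threshold g"
begin

abbreviation F :: "'a \<Rightarrow> 'b \<Rightarrow> real" where "F \<equiv> smooth_part f c \<mu> yhat"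
abbreviation P :: "'a \<times> 'b \<Rightarrow> ereal" where "P \<equiv> penalty f c g \<mu> yhat"
abbreviation G :: "'a \<Rightarrow> 'b \<Rightarrow> 'a" where "G \<equiv> \<lambda>u w. grad (\<lambda>u'. F u' w) u"
abbreviation Orc :: "'a \<Rightarrow> 'b set" where "Orc \<equiv> oracle_set P"

text \<open>
  By \<open>marginal_finite\<close> the coercion to a real number loses nothing, and it keeps the line-search
  estimates within real arithmetic.
\<close>

definition p :: "'a \<Rightarrow> real" where "p u = real_of_ereal (marginal P u)"

lemma P_eq: "P (u, w) = ereal (F u w) + g w"
  by (simp add: penalty_def)

subsection \<open>The smooth part\<close>

text \<open>
  The quadratic term in \<open>z\<close> does not depend on the first variable. So the variation of \<open>F\<close> in that
  variable is affine in \<open>z\<close>, and estimates at one value of \<open>z\<close> carry over to all bounded \<open>z\<close> at once.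
\<close>

lemma F_diff:
  "F w z - F u z = F w z' - F u z' - (1 / \<mu>) * ((c w - c u) \<bullet> (z - z'))"
  using \<mu>_pos
  by (simp add: smooth_part_def power2_norm_eq_inner inner_diff_left inner_diff_right
      inner_add_left inner_add_right inner_commute field_simps)

lemma F_C1: "continuously_differentiable (\<lambda>u. F u z)"
  using C1_add_scaled[OF f_C1 C1_norm_square[OF c_C1, of "\<mu> *\<^sub>R yhat - z"], of "1 / (2 * \<mu>)"]
  by (simp add: smooth_part_def algebra_simps)

lemma F_has_derivative: "((\<lambda>u. F u z) has_derivative (\<lambda>v. G u z \<bullet> v)) (at u)"
  using F_C1 has_derivative_grad by (metis C1_differentiable)

text \<open>
  By the affine dependence on \<open>z\<close>, the remainder of the expansion of \<open>F(\<cdot>, z)\<close> is that of \<open>F(\<cdot>, 0)\<close>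
  minus $\langle q, z\rangle/\mu$, where \<open>q\<close> is the remainder of \<open>c\<close>; each gets half of the error budget.
\<close>

lemma F_linearization_uniform:
  assumes "0 < e"
  obtains \<delta> where "0 < \<delta>"
    and "\<And>u w z. \<lbrakk>u \<in> ball a \<delta>; w \<in> ball a \<delta>; norm z \<le> R\<rbrakk>
           \<Longrightarrow> F w z - F u z \<le> G u z \<bullet> (w - u) + e * norm (w - u)"
proof -
  define s where "s = e * \<mu> / (2 * (\<bar>R\<bar> + 1))"
  have "0 < s"
    using assms \<mu>_pos by (simp add: s_def)
  obtain \<delta>1 where "0 < \<delta>1" and \<delta>1:
      "\<And>u w D. \<lbrakk>u \<in> ball a \<delta>1; w \<in> ball a \<delta>1; ((\<lambda>u. F u 0) has_derivative D) (at u)\<rbrakk>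
         \<Longrightarrow> norm (F w 0 - F u 0 - D (w - u)) \<le> e / 2 * norm (w - u)"
    using C1_strictly_differentiable[OF F_C1, of "e / 2"] assms by (metis half_gt_zero)
  obtain \<delta>2 where "0 < \<delta>2" and \<delta>2:
      "\<And>u w D. \<lbrakk>u \<in> ball a \<delta>2; w \<in> ball a \<delta>2; (c has_derivative D) (at u)\<rbrakk>
         \<Longrightarrow> norm (c w - c u - D (w - u)) \<le> s * norm (w - u)"
    using C1_strictly_differentiable[OF c_C1 \<open>0 < s\<close>] by metis
  show thesis
  proof
    show "0 < min \<delta>1 \<delta>2"
      using \<open>0 < \<delta>1\<close> \<open>0 < \<delta>2\<close> by simp
    fix u w :: 'a and z :: 'b
    assume u: "u \<in> ball a (min \<delta>1 \<delta>2)" and w: "w \<in> ball a (min \<delta>1 \<delta>2)" and z: "norm z \<le> R"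
    obtain D where D: "(c has_derivative D) (at u)"
      using c_C1 by (rule C1_differentiable)
    \<comment> \<open>Express the gradient at \<open>z\<close> by the one at \<open>0\<close>, matching the splitting of the remainder.\<close>
    have "((\<lambda>u. F u z) has_derivative (\<lambda>v. G u 0 \<bullet> v - (1 / \<mu>) * (D v \<bullet> z))) (at u)"
    proof -
      have "(\<lambda>u'. F u' z) = (\<lambda>u'. F u' 0 - (1 / \<mu>) * ((c u' - c u) \<bullet> z) + (F u z - F u 0))"
        using F_diff[of _ z u 0] by (auto simp: fun_eq_iff algebra_simps)
      then show ?thesis
        using \<mu>_pos by (auto intro!: derivative_eq_intros D F_has_derivative)
    qed
    then have Gz: "G u z \<bullet> v = G u 0 \<bullet> v - (1 / \<mu>) * (D v \<bullet> z)" for v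
      by (metis has_derivative_grad)
    define q where "q = c w - c u - D (w - u)"
    have "\<bar>q \<bullet> z\<bar> \<le> norm q * norm z"
      by (rule Cauchy_Schwarz_ineq2)
    also have "\<dots> \<le> (s * norm (w - u)) * (\<bar>R\<bar> + 1)"
      using \<delta>2[OF _ _ D, of w] u w z \<open>0 < s\<close> unfolding q_def by (intro mult_mono) auto
    also have "\<dots> = \<mu> * (e / 2 * norm (w - u))"
      by (simp add: s_def field_simps)
    finally have "(1 / \<mu>) * \<bar>q \<bullet> z\<bar> \<le> e / 2 * norm (w - u)"
      using \<mu>_pos by (simp add: field_simps)
    moreover have "- ((1 / \<mu>) * (q \<bullet> z)) \<le> (1 / \<mu>) * \<bar>q \<bullet> z\<bar>"
      using \<mu>_pos by (simp add: field_simps abs_if)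
    ultimately have 1: "- ((1 / \<mu>) * (q \<bullet> z)) \<le> e / 2 * norm (w - u)"
      by linarith
    have 2: "F w 0 - F u 0 - G u 0 \<bullet> (w - u) \<le> e / 2 * norm (w - u)"
      using order_trans[OF abs_ge_self \<delta>1[OF _ _ F_has_derivative, of u w, unfolded real_norm_def]] u w
      by simp
    have "F w z - F u z - G u z \<bullet> (w - u) =
        (F w 0 - F u 0 - G u 0 \<bullet> (w - u)) - (1 / \<mu>) * (q \<bullet> z)"
      unfolding Gz using F_diff[of w z u 0] by (simp add: q_def algebra_simps diff_divide_distrib)
    then show "F w z - F u z \<le> G u z \<bullet> (w - u) + e * norm (w - u)"
      using 1 2 by linarith
  qed
qed

subsection \<open>Solvability of the inner problem\<close>

lemma prox_parameter_above:
  obtains \<gamma> M where "\<mu> < \<gamma>" and "\<And>w. ereal M \<le> g w + ereal ((norm w)\<^sup>2 / (2 * \<gamma>))"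
proof -
  obtain \<gamma> where "\<gamma> \<in> prox_parameters g" "\<mu> < \<gamma>"
    using \<mu>_threshold unfolding prox_threshold_def less_Sup_iff by auto
  then show thesis
    using that unfolding prox_parameters_def by auto
qed

text \<open>
  For some \<open>\<gamma> > \<mu>\<close> the function \<open>g\<close> is bounded below by a constant minus $t\|w\|^2$ with
  $t = 1/(2\gamma)$, while the penalty contributes $s\|k-w\|^2$ with $s = 1/(2\mu) > t$ and
  $k = c(u) + \mu\hat y$. The cross term is absorbed by half of the surplus $s - t$ through Young's
  inequality, and the terms in \<open>k\<close> and \<open>f\<close> are bounded on a compact set.
\<close>

lemma penalty_coercive:
  assumes "compact K"
  obtains \<kappa> B where "0 < \<kappa>" and "\<And>u w. u \<in> K \<Longrightarrow> ereal (B + \<kappa> * (norm w)\<^sup>2) \<le> P (u, w)"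
proof -
  obtain \<gamma> M where \<gamma>: "\<mu> < \<gamma>" and M: "\<And>w. ereal M \<le> g w + ereal ((norm w)\<^sup>2 / (2 * \<gamma>))"
    by (rule prox_parameter_above) blast
  define s t where "s = 1 / (2 * \<mu>)" and "t = 1 / (2 * \<gamma>)"
  have "t < s" "0 < s"
    using \<gamma> \<mu>_pos by (auto simp: s_def t_def field_simps)
  \<comment> \<open>The constant that Young's inequality leaves in front of $\|k\|^2$.\<close>
  define C where "C = 2 * s\<^sup>2 / (s - t)"
  define l where "l u = f u - C * (norm (c u + \<mu> *\<^sub>R yhat))\<^sup>2" for u
  have "compact (l ` K)"
    unfolding l_def
    by (intro compact_continuous_image continuous_intros C1_continuous_on f_C1 c_C1 assms)
  then obtain b where b: "\<And>u. u \<in> K \<Longrightarrow> b \<le> l u"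
    by (meson bounded_imp_bdd_below bdd_below.unfold compact_imp_bounded imageI)
  show thesis
  proof
    show "0 < (s - t) / 2"
      using \<open>t < s\<close> by simp
    fix u :: 'a and w :: 'b assume "u \<in> K"
    define k where "k = c u + \<mu> *\<^sub>R yhat"
    have "2 * s * (norm k * norm w) \<le> C * (norm k)\<^sup>2 + (s - t) / 2 * (norm w)\<^sup>2"
    proof -
      have "0 \<le> (2 * s * norm k - (s - t) * norm w)\<^sup>2 / (2 * (s - t))"
        using \<open>t < s\<close> by simp
      also have "\<dots> = C * (norm k)\<^sup>2 + (s - t) / 2 * (norm w)\<^sup>2 - 2 * s * (norm k * norm w)"
        using \<open>t < s\<close> by (simp add: C_def field_simps power2_eq_square)
      finally show ?thesis by simp
    qed
    moreover have "2 * s * (k \<bullet> w) \<le> 2 * s * (norm k * norm w)"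
      using norm_cauchy_schwarz[of k w] \<open>0 < s\<close> by simp
    moreover have "s * (norm (k - w))\<^sup>2 = s * (norm k)\<^sup>2 - 2 * s * (k \<bullet> w) + s * (norm w)\<^sup>2"
      by (simp add: power2_norm_eq_inner inner_diff_left inner_diff_right inner_commute algebra_simps)
    moreover have "0 \<le> s * (norm k)\<^sup>2"
      using \<open>0 < s\<close> by simp
    moreover have "(s - t) / 2 * (norm w)\<^sup>2 = s * (norm w)\<^sup>2 - t * (norm w)\<^sup>2 - (s - t) / 2 * (norm w)\<^sup>2"
      by (simp add: field_simps)
    ultimately have "(s - t) / 2 * (norm w)\<^sup>2 - C * (norm k)\<^sup>2 + t * (norm w)\<^sup>2 \<le> s * (norm (k - w))\<^sup>2"
      by linarith
    then have "b + M + (s - t) / 2 * (norm w)\<^sup>2 \<le> F u w + (M - t * (norm w)\<^sup>2)"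
      using b[OF \<open>u \<in> K\<close>] by (simp add: smooth_part_def s_def l_def k_def)
    moreover have "ereal (M - t * (norm w)\<^sup>2) \<le> g w"
      using M[of w] by (cases "g w") (auto simp: t_def)
    ultimately show "ereal (b + M + (s - t) / 2 * (norm w)\<^sup>2) \<le> P (u, w)"
      unfolding P_eq by (cases "g w") auto
  qed
qed

lemma marginal_finite: "marginal P u = ereal (p u)"
proof -
  obtain \<kappa> B where "0 < \<kappa>" and B: "\<And>w. ereal (B + \<kappa> * (norm w)\<^sup>2) \<le> P (u, w)"
    using penalty_coercive[of "{u}"] by (metis finite.emptyI finite_imp_compact finite_insert singletonI)
  have "ereal B \<le> P (u, w)" for w
    using B[of w] \<open>0 < \<kappa>\<close> by (smt (verit) ereal_less_eq(3) mult_nonneg_nonneg order_trans zero_le_power2)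
  then have "ereal B \<le> marginal P u"
    unfolding marginal_def by (intro INF_greatest)
  moreover obtain w where "g w < \<infinity>"
    using g_proper unfolding proper_def effective_dom_def by auto
  then have "P (u, w) < \<infinity>"
    by (simp add: P_eq)
  then have "marginal P u < \<infinity>"
    unfolding marginal_def by (meson INF_lower UNIV_I le_less_trans)
  ultimately show ?thesis
    unfolding p_def by (cases "marginal P u") auto
qed

lemma p_le_P: "ereal (p u) \<le> P (u, w)"
  unfolding marginal_finite[symmetric] marginal_def by (rule INF_lower) simp

lemma oracle_iff: "w \<in> Orc u \<longleftrightarrow> P (u, w) = ereal (p u)"
proof
  assume "w \<in> Orc u"
  then have "\<forall>w'. P (u, w) \<le> P (u, w')"
    by (simp add: oracle_set_def is_arg_min_def not_less)
  then have "P (u, w) \<le> marginal P u"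
    unfolding marginal_def by (intro INF_greatest) blast
  then show "P (u, w) = ereal (p u)"
    using p_le_P[of u w] marginal_finite by (metis antisym)
next
  assume "P (u, w) = ereal (p u)"
  then show "w \<in> Orc u"
    using p_le_P[of u] by (simp add: oracle_set_def is_arg_min_def not_less)
qed

text \<open>
  The direct method: a minimizing sequence is bounded by coercivity, and at a cluster point of it
  lower semicontinuity keeps the value from jumping up.
\<close>

lemma oracle_nonempty: "Orc u \<noteq> {}"
proof -
  obtain \<kappa> B where "0 < \<kappa>" and B: "\<And>w. ereal (B + \<kappa> * (norm w)\<^sup>2) \<le> P (u, w)"
    using penalty_coercive[of "{u}"] by (metis finite.emptyI finite_imp_compact finite_insert singletonI)
  have "\<exists>w. P (u, w) < ereal (p u + inverse (real (Suc k)))" for k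
  proof -
    have "marginal P u < ereal (p u + inverse (real (Suc k)))"
      by (simp add: marginal_finite)
    then show ?thesis
      by (simp add: marginal_def INF_less_iff)
  qed
  then obtain w where w: "\<And>k. P (u, w k) < ereal (p u + inverse (real (Suc k)))"
    by metis
  have "bounded (range w)"
  proof -
    have "(norm (w k))\<^sup>2 \<le> (p u + 1 - B) / \<kappa>" for k
    proof -
      have "B + \<kappa> * (norm (w k))\<^sup>2 < p u + inverse (real (Suc k))"
        using le_less_trans[OF B w] by simp
      moreover have "inverse (real (Suc k)) \<le> 1"
        by (simp add: field_simps)
      ultimately have "\<kappa> * (norm (w k))\<^sup>2 \<le> p u + 1 - B"
        by linarith
      then show ?thesis
        using \<open>0 < \<kappa>\<close> by (simp add: field_simps)
    qed
    then show ?thesis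
      by (auto simp: bounded_iff intro!: exI[of _ "sqrt ((p u + 1 - B) / \<kappa>)"] real_le_rsqrt)
  qed
  then obtain w0 r where r: "strict_mono r" and lim: "(w \<circ> r) \<longlonglongrightarrow> w0"
    using bounded_imp_convergent_subsequence by blast
  have "P (u, w0) \<le> ereal (p u)"
  proof (rule ccontr)
    assume "\<not> P (u, w0) \<le> ereal (p u)"
    then have "ereal (p u - F u w0) < g w0"
      unfolding P_eq by (cases "g w0") auto
    \<comment> \<open>A real number strictly in between turns lower semicontinuity into an inequality between real
      sequences, although \<open>g\<close> may be infinite at \<open>w0\<close>.\<close>
    then obtain T where T: "ereal (p u - F u w0) < ereal T" "ereal T < g w0"
      using ereal_dense2 by blast
    have "ereal T < Liminf (at w0) g"
      using T(2) g_lsc unfolding lower_semicontinuous_def by (meson less_le_trans)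
    then have "eventually (\<lambda>w. ereal T < g w) (at w0)"
      by (rule less_LiminfD)
    then have "eventually (\<lambda>w. ereal T < g w) (nhds w0)"
      unfolding eventually_at_filter
    proof eventually_elim
      case (elim w)
      then show ?case
        using T(2) by (cases "w = w0") auto
    qed
    then have "eventually (\<lambda>k. ereal T < g (w (r k))) sequentially"
      using lim unfolding filterlim_iff comp_def by blast
    then have ev: "eventually (\<lambda>k. F u (w (r k)) + T \<le> p u + inverse (real (Suc (r k)))) sequentially"
    proof eventually_elim
      case (elim k)
      with w[of "r k"] show ?case
        unfolding P_eq by (cases "g (w (r k))") auto
    qed
    have "(\<lambda>k. F u (w (r k)) + T) \<longlonglongrightarrow> F u w0 + T"
      using lim \<mu>_pos unfolding smooth_part_def comp_def by (intro tendsto_intros) auto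
    moreover have "(\<lambda>k. p u + inverse (real (Suc (r k)))) \<longlonglongrightarrow> p u + 0"
      using LIMSEQ_subseq_LIMSEQ[OF LIMSEQ_inverse_real_of_nat r]
      by (intro tendsto_add tendsto_const) (simp add: comp_def)
    ultimately have "F u w0 + T \<le> p u + 0"
      using ev by (intro tendsto_le[OF sequentially_bot])
    with T(1) show False
      by simp
  qed
  then have "w0 \<in> Orc u"
    using p_le_P[of u w0] by (simp add: oracle_iff)
  then show ?thesis
    by blast
qed

text \<open>
  A fixed point of the domain of \<open>g\<close> bounds \<open>p\<close> above on a compact set, and coercivity turns this into
  a bound on the minimizers.
\<close>

lemma oracle_locally_bounded:
  assumes "compact K"
  obtains R m where "\<And>u. u \<in> K \<Longrightarrow> m \<le> p u" and "\<And>u w. u \<in> K \<Longrightarrow> w \<in> Orc u \<Longrightarrow> norm w \<le> R"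
proof -
  obtain \<kappa> B where "0 < \<kappa>" and B: "\<And>u w. u \<in> K \<Longrightarrow> ereal (B + \<kappa> * (norm w)\<^sup>2) \<le> P (u, w)"
    using penalty_coercive[OF assms] by blast
  obtain w0 where "g w0 < \<infinity>"
    using g_proper unfolding proper_def effective_dom_def by auto
  moreover have "g w0 \<noteq> -\<infinity>"
    using g_proper unfolding proper_def by auto
  ultimately obtain \<rho> where \<rho>: "g w0 = ereal \<rho>"
    by (cases "g w0") auto
  have "compact ((\<lambda>u. F u w0 + \<rho>) ` K)"
    by (intro compact_continuous_image continuous_intros C1_continuous_on F_C1 assms)
  then obtain b where b: "\<And>u. u \<in> K \<Longrightarrow> F u w0 + \<rho> \<le> b"
    by (meson bounded_imp_bdd_above bdd_above.unfold compact_imp_bounded imageI)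
  have bound: "B + \<kappa> * (norm w)\<^sup>2 \<le> p u" if "u \<in> K" "w \<in> Orc u" for u w
    using B[OF that(1), of w] that(2) by (simp add: oracle_iff)
  show thesis
  proof
    show "B \<le> p u" if "u \<in> K" for u
    proof -
      obtain w where "w \<in> Orc u"
        using oracle_nonempty by blast
      moreover have "0 \<le> \<kappa> * (norm w)\<^sup>2"
        using \<open>0 < \<kappa>\<close> by simp
      ultimately show ?thesis
        using bound[OF that] by fastforce
    qed
    show "norm w \<le> sqrt ((b - B) / \<kappa>)" if "u \<in> K" "w \<in> Orc u" for u w
    proof (rule real_le_rsqrt)
      have "p u \<le> b"
        using p_le_P[of u w0] b[OF that(1)] by (simp add: P_eq \<rho>)
      then show "(norm w)\<^sup>2 \<le> (b - B) / \<kappa>"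
        using bound[OF that] \<open>0 < \<kappa>\<close> by (simp add: field_simps)
    qed
  qed
qed

text \<open>
  Both sides are compared through \<open>P(w, z)\<close>: the same \<open>z\<close> is feasible for \<open>w\<close> and optimal for \<open>u\<close>, so
  the possibly very irregular \<open>g z\<close> cancels.
\<close>

lemma marginal_majorized:
  assumes "z \<in> Orc u"
  shows "p w \<le> p u + (F w z - F u z)"
  using p_le_P[of w z] assms unfolding oracle_iff P_eq by (cases "g z") auto

subsection \<open>Stationarity\<close>

text \<open>
  Since \<open>z\<close> minimizes \<open>P(u, \<cdot>)\<close>, we have $g(z') \ge P(u,z) - F(u,z')$, and hence
  $P(u',z') - P(u,z) \ge F(u',z') - F(u,z')$. The right-hand side is a function \<open>H\<close> that vanishes at
  \<open>(u, z)\<close> and is differentiable there jointly in both variables with gradient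
  $(\nabla_x F(u,z), 0)$, because by \<open>F_diff\<close> its \<open>z'\<close>-dependence is a product of two factors that
  both vanish at \<open>(u, z)\<close>. A smooth lower support yields a regular subgradient.
\<close>

lemma gradient_in_regular_subdifferential:
  assumes "z \<in> Orc u"
  shows "(G u z, 0) \<in> regular_subdifferential P (u, z)"
proof -
  define H where "H y = F (fst y) (snd y) - F u (snd y)" for y
  define D :: "'a \<times> 'b \<Rightarrow> real" where "D y = G u z \<bullet> fst y" for y
  obtain c' where c': "(c has_derivative c') (at u)"
    using c_C1 by (rule C1_differentiable)
  have "(H has_derivative D) (at (u, z))"
  proof -
    have "H = (\<lambda>y. F (fst y) z - F u z - (1 / \<mu>) * ((c (fst y) - c u) \<bullet> (snd y - z)))"
      using F_diff by (auto simp: H_def fun_eq_iff)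
    moreover have "((\<lambda>y. F (fst y) z) has_derivative (\<lambda>y. G u z \<bullet> fst y)) (at (u, z))"
      by (rule has_derivative_compose[OF has_derivative_fst[OF has_derivative_ident]])
        (simp add: F_has_derivative)
    moreover have "((\<lambda>y. c (fst y)) has_derivative (\<lambda>y. c' (fst y))) (at (u, z))"
      by (rule has_derivative_compose[OF has_derivative_fst[OF has_derivative_ident]]) (simp add: c')
    ultimately show ?thesis
      using \<mu>_pos unfolding D_def by (auto intro!: derivative_eq_intros)
  qed
  then have lim: "((\<lambda>y. (H y - H (u, z) - D (y - (u, z))) / norm (y - (u, z))) \<longlongrightarrow> 0) (at (u, z))"
    unfolding has_derivative_at_within by (simp add: divide_inverse_commute)
  have "0 \<le> Liminf (at (u, z))
      (\<lambda>y. (P y - P (u, z) - ereal ((G u z, 0) \<bullet> (y - (u, z)))) / ereal (norm (y - (u, z))))"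
    unfolding le_Liminf_iff
  proof (intro allI impI)
    fix s :: ereal assume "s < 0"
    have "((\<lambda>y. ereal ((H y - H (u, z) - D (y - (u, z))) / norm (y - (u, z)))) \<longlongrightarrow> ereal 0) (at (u, z))"
      using lim by (intro tendsto_intros)
    then have "\<forall>\<^sub>F y in at (u, z). s < ereal ((H y - H (u, z) - D (y - (u, z))) / norm (y - (u, z)))"
      by (rule order_tendstoD(1)) (use \<open>s < 0\<close> in \<open>simp add: zero_ereal_def\<close>)
    moreover have "\<forall>\<^sub>F y in at (u, z). y \<noteq> (u, z)"
      by (simp add: eventually_at_filter)
    ultimately show "\<forall>\<^sub>F y in at (u, z).
        s < (P y - P (u, z) - ereal ((G u z, 0) \<bullet> (y - (u, z)))) / ereal (norm (y - (u, z)))"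
    proof eventually_elim
      case (elim y)
      obtain u' z' where y: "y = (u', z')"
        by fastforce
      have pos: "0 < norm (y - (u, z))"
        using elim by simp
      have "H y \<le> F u' z' + t - p u" if "g z' = ereal t" for t
        using p_le_P[of u z'] that by (simp add: H_def y P_eq)
      then have "ereal (H y - D (y - (u, z))) \<le> P y - P (u, z) - ereal ((G u z, 0) \<bullet> (y - (u, z)))"
        using assms g_proper unfolding oracle_iff proper_def
        by (cases "g z'") (auto simp: y P_eq D_def inner_prod_def)
      then have "ereal (H y - D (y - (u, z))) / ereal (norm (y - (u, z))) \<le>
          (P y - P (u, z) - ereal ((G u z, 0) \<bullet> (y - (u, z)))) / ereal (norm (y - (u, z)))"
        using pos by (intro ereal_divide_right_mono) auto
      moreover have "H (u, z) = 0"
        by (simp add: H_def)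
      ultimately show ?case
        using elim pos by (auto intro: less_le_trans)
    qed
  qed
  then show ?thesis
    using assms unfolding oracle_iff regular_subdifferential_def by auto
qed

lemma returned_point_stationary:
  assumes "returns_at Orc G \<epsilon> u z"
  shows "upsilon_stationary P \<epsilon> u z"
proof -
  have z: "z \<in> Orc u" "norm (G u z) \<le> \<epsilon>"
    using assms unfolding returns_at_def by auto
  have "(G u z, 0) \<in> limiting_subdifferential P (u, z)"
    using gradient_in_regular_subdifferential[OF z(1)] z(1)
    unfolding limiting_subdifferential_def oracle_iff
    by (intro CollectI conjI exI[of _ "\<lambda>_. (u, z)"] exI[of _ "\<lambda>_. (G u z, 0)"]) auto
  then show ?thesis
    using z unfolding upsilon_stationary_def by (auto simp: effective_dom_def marginal_finite)
qed

section \<open>Well-definedness of the method\<close>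

lemma acceptable_step_real:
  "acceptable_step (marginal P) \<alpha> (ereal \<phi>) u v d \<gamma> u' \<longleftrightarrow>
     p u' \<le> p (u + \<gamma> *\<^sub>R d) \<and> p (u + \<gamma> *\<^sub>R d) \<le> \<phi> + \<alpha> * \<gamma> * (v \<bullet> d)"
  by (simp add: acceptable_step_def marginal_finite)

text \<open>
  The difference quotient of \<open>F(\<cdot>, z)\<close> along \<open>d\<close> tends to a negative slope and thus falls below the
  fraction \<open>\<alpha>\<close> of it; by majorization \<open>p\<close> decreases at least as much. The merit value only relaxes the
  test, as it dominates \<open>p u\<close>.
\<close>

lemma backtracking_terminates:
  assumes z: "z \<in> Orc u" and v: "G u z \<bullet> d < 0"
    and "p u \<le> \<phi>" and \<beta>: "0 < \<beta>" "\<beta> < 1" and \<alpha>: "\<alpha> < 1"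
  shows "\<exists>\<l> u'. acceptable_step (marginal P) \<alpha> (ereal \<phi>) u (G u z) d (\<beta> ^ \<l>) u'"
proof -
  define s where "s = G u z \<bullet> d"
  have "((\<lambda>t. F (u + t *\<^sub>R d) z) has_derivative (\<lambda>t. G u z \<bullet> (t *\<^sub>R d))) (at 0)"
  proof (rule has_derivative_compose[of "\<lambda>t. u + t *\<^sub>R d" "\<lambda>t. t *\<^sub>R d" _ _ "\<lambda>u. F u z"])
    show "((\<lambda>t. u + t *\<^sub>R d) has_derivative (\<lambda>t. t *\<^sub>R d)) (at 0)"
      by (auto intro!: derivative_eq_intros)
  qed (simp add: F_has_derivative)
  then have "((\<lambda>t. F (u + t *\<^sub>R d) z) has_field_derivative s) (at 0)"
    by (simp add: has_field_derivative_def s_def mult.commute[of _ "G u z \<bullet> d"] mult_commute_abs)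
  then have "((\<lambda>t. (F (u + t *\<^sub>R d) z - F u z) / t) \<longlongrightarrow> s) (at 0)"
    by (simp add: DERIV_def)
  moreover have "s < \<alpha> * s"
    using v \<alpha> by (simp add: s_def)
  ultimately have ev: "\<forall>\<^sub>F t in at 0. (F (u + t *\<^sub>R d) z - F u z) / t < \<alpha> * s"
    by (rule order_tendstoD(2))
  have "filterlim (\<lambda>n. \<beta> ^ n) (at 0) sequentially"
    using \<beta> by (auto simp: filterlim_at intro!: LIMSEQ_power_zero)
  from eventually_compose_filterlim[OF ev this]
  obtain \<l> where "(F (u + \<beta> ^ \<l> *\<^sub>R d) z - F u z) / \<beta> ^ \<l> < \<alpha> * s"
    by (auto simp: eventually_sequentially)
  then have "F (u + \<beta> ^ \<l> *\<^sub>R d) z - F u z \<le> \<alpha> * \<beta> ^ \<l> * s"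
    using \<beta> by (simp add: field_simps)
  then have "p (u + \<beta> ^ \<l> *\<^sub>R d) \<le> \<phi> + \<alpha> * \<beta> ^ \<l> * s"
    using marginal_majorized[OF z, of "u + \<beta> ^ \<l> *\<^sub>R d"] \<open>p u \<le> \<phi>\<close> by linarith
  then show ?thesis
    unfolding acceptable_step_real s_def by blast
qed

lemma admissible_direction_descent:
  assumes "admissible_direction \<theta> \<omega> v d" and "0 \<le> \<epsilon>" "\<epsilon> < norm v" and "0 < \<theta>" "0 < \<omega>"
  shows "\<omega> * \<epsilon> \<le> norm d" and "v \<bullet> d \<le> - (\<theta> * \<epsilon> * norm d)" and "v \<bullet> d < 0"
proof -
  have d: "\<omega> * norm v \<le> norm d" and vd: "v \<bullet> d \<le> - \<theta> * norm v * norm d"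
    using assms(1) by (auto simp: admissible_direction_def)
  show "\<omega> * \<epsilon> \<le> norm d"
    using d assms by (smt (verit) mult_less_cancel_left_pos)
  have "\<theta> * \<epsilon> * norm d \<le> \<theta> * norm v * norm d"
    using assms by (intro mult_mono) auto
  then show "v \<bullet> d \<le> - (\<theta> * \<epsilon> * norm d)"
    using vd by simp
  have "0 < norm v"
    using assms by linarith
  moreover from this have "0 < norm d"
    using d assms(5) by (smt (verit) mult_pos_pos)
  ultimately have "0 < \<theta> * norm v * norm d"
    using assms by simp
  then show "v \<bullet> d < 0"
    using vd by simp
qed

lemma no_breakdown:
  assumes "p u \<le> \<phi>" and "0 < \<epsilon>" and "0 < \<beta>" "\<beta> < 1" and "\<alpha> < 1"
    and "0 < \<theta>" "\<theta> < 1" and "0 < \<omega>" "\<omega> \<le> 1"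
  shows "\<not> breaks_down (marginal P) Orc G \<epsilon> \<alpha> \<beta> \<theta> \<omega> u z d (ereal \<phi>)"
proof -
  have "admissible_direction \<theta> \<omega> v (- v)" for v :: 'a
  proof -
    have "\<theta> * (norm v * norm v) \<le> 1 * (norm v * norm v)" "\<omega> * norm v \<le> 1 * norm v"
      using assms by (intro mult_right_mono; simp)+
    then show ?thesis
      by (simp add: admissible_direction_def dot_square_norm power2_eq_square mult.assoc)
  qed
  moreover have "\<exists>\<l> u'. acceptable_step (marginal P) \<alpha> (ereal \<phi>) u (G u z) d (\<beta> ^ \<l>) u'"
    if "z \<in> Orc u" "\<epsilon> < norm (G u z)" "admissible_direction \<theta> \<omega> (G u z) d"
  proof (rule backtracking_terminates)
    show "G u z \<bullet> d < 0"
      using admissible_direction_descent(3)[OF that(3) _ that(2)] assms by simp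
  qed (use that assms in auto)
  ultimately show ?thesis
    using oracle_nonempty unfolding breaks_down_def not_le by blast
qed

section \<open>Finite termination\<close>

text \<open>
  The new merit value is a convex combination of the old one and of \<open>p x'\<close>. So it inherits the
  fraction \<open>\<nu>\<close> of the decrease that the line search guarantees, and it stays above \<open>p x'\<close>, which is the
  invariant that the next line search needs. The decrease is measured by the trial step length
  \<open>\<beta> ^ \<l> * norm d\<close>: the actual new point is only known to be at least as good as the trial point and
  may lie far from it.
\<close>

lemma iteration_decrease:
  assumes it: "iteration (marginal P) Orc G \<epsilon> \<alpha> \<beta> \<theta> \<omega> \<nu> x z d \<l> (ereal \<phi>) x' \<phi>'"
    and "0 < \<epsilon>" and "0 < \<alpha>" and "0 < \<beta>" and "0 < \<theta>" and "0 < \<omega>" and \<nu>: "0 < \<nu>" "\<nu> \<le> 1"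
  obtains \<psi> where "\<phi>' = ereal \<psi>" and "p x' \<le> \<psi>"
    and "\<psi> \<le> \<phi> - \<nu> * \<alpha> * \<theta> * \<epsilon> * (\<beta> ^ \<l> * norm d)"
proof
  define \<psi> where "\<psi> = (1 - \<nu>) * \<phi> + \<nu> * p x'"
  show "\<phi>' = ereal \<psi>"
    using it by (simp add: iteration_def \<psi>_def marginal_finite)
  have dir: "admissible_direction \<theta> \<omega> (G x z) d" and "\<epsilon> < norm (G x z)"
    and acc: "p x' \<le> \<phi> + \<alpha> * \<beta> ^ \<l> * (G x z \<bullet> d)"
    using it unfolding iteration_def acceptable_step_real by auto
  then have "G x z \<bullet> d \<le> - (\<theta> * \<epsilon> * norm d)"
    using admissible_direction_descent(2)[OF dir] assms by simp
  then have "\<alpha> * \<beta> ^ \<l> * (G x z \<bullet> d) \<le> \<alpha> * \<beta> ^ \<l> * (- (\<theta> * \<epsilon> * norm d))"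
    using assms by (intro mult_left_mono) auto
  then have dec: "p x' \<le> \<phi> - \<alpha> * \<theta> * \<epsilon> * (\<beta> ^ \<l> * norm d)"
    using acc by (simp add: algebra_simps)
  moreover have "0 \<le> \<alpha> * \<theta> * \<epsilon> * (\<beta> ^ \<l> * norm d)"
    using assms by simp
  ultimately have "0 \<le> (1 - \<nu>) * (\<phi> - p x')"
    using \<nu> by simp
  then show "p x' \<le> \<psi>"
    by (simp add: \<psi>_def algebra_simps)
  have "\<nu> * (p x') \<le> \<nu> * (\<phi> - \<alpha> * \<theta> * \<epsilon> * (\<beta> ^ \<l> * norm d))"
    using dec \<nu> by (intro mult_left_mono) auto
  then show "\<psi> \<le> \<phi> - \<nu> * \<alpha> * \<theta> * \<epsilon> * (\<beta> ^ \<l> * norm d)"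
    by (simp add: \<psi>_def algebra_simps)
qed

text \<open>
  The index \<open>N\<close> is included, since the last iterate of a finite run is the one to be examined for a
  breakdown.
\<close>

lemma run_merit_bound:
  assumes run: "descent_run (marginal P) Orc G \<epsilon> \<alpha> \<beta> \<theta> \<omega> \<nu> N x z d \<l> \<Phi>"
    and par: "0 < \<epsilon>" "0 < \<alpha>" "0 < \<beta>" "0 < \<theta>" "0 < \<omega>" "0 < \<nu>" "\<nu> \<le> 1"
    and "enat j \<le> N"
  shows "\<exists>\<phi>. \<Phi> j = ereal \<phi> \<and> p (x j) \<le> \<phi>"
  using \<open>enat j \<le> N\<close>
proof (induction j)
  case 0
  then show ?case
    using run by (simp add: descent_run_def marginal_finite)
next
  case (Suc j)
  have j: "enat j < N"
    using Suc.prems by (simp add: Suc_ile_eq)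
  then obtain \<phi> where "\<Phi> j = ereal \<phi>"
    using Suc.IH by (auto simp: less_imp_le)
  then have "iteration (marginal P) Orc G \<epsilon> \<alpha> \<beta> \<theta> \<omega> \<nu> (x j) (z j) (d j) (\<l> j) (ereal \<phi>)
      (x (Suc j)) (\<Phi> (Suc j))"
    using run j unfolding descent_run_def by metis
  then show ?case
    using iteration_decrease par by blast
qed

text \<open>
  The step lengths vanish, so along the convergent subsequence the last rejected step also becomes
  short, and the uniform expansion of \<open>F\<close> at accuracy $(1-\alpha)\theta\epsilon$ contradicts its
  rejection. The directions themselves may be unbounded; only the products of step sizes and direction
  lengths are controlled, and these suffice.
\<close>

lemma infinite_run_no_accumulation:
  assumes run: "descent_run (marginal P) Orc G \<epsilon> \<alpha> \<beta> \<theta> \<omega> \<nu> \<infinity> x z d \<l> \<Phi>"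
    and par: "0 < \<epsilon>" "0 < \<alpha>" "\<alpha> < 1" "0 < \<beta>" "\<beta> < 1" "0 < \<theta>" "0 < \<omega>" "0 < \<nu>" "\<nu> \<le> 1"
  shows "\<not> accumulation_point x a"
proof
  assume "accumulation_point x a"
  then obtain r where r: "strict_mono r" and lim: "(\<lambda>k. x (r k)) \<longlonglongrightarrow> a"
    unfolding accumulation_point_def comp_def by blast
  have "\<exists>\<phi>. \<Phi> j = ereal \<phi> \<and> p (x j) \<le> \<phi>" for j
    using run_merit_bound[OF run, of j] par by simp
  then obtain \<phi> where \<phi>: "\<And>j. \<Phi> j = ereal (\<phi> j)" and p\<phi>: "\<And>j. p (x j) \<le> \<phi> j"
    by metis
  have it: "iteration (marginal P) Orc G \<epsilon> \<alpha> \<beta> \<theta> \<omega> \<nu> (x j) (z j) (d j) (\<l> j) (ereal (\<phi> j))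
      (x (Suc j)) (ereal (\<phi> (Suc j)))" for j
    using run unfolding descent_run_def \<phi> by simp
  define q where "q = \<nu> * \<alpha> * \<theta> * \<epsilon>"
  have "0 < q"
    using par by (simp add: q_def)
  define \<sigma> where "\<sigma> j = \<beta> ^ \<l> j * norm (d j)" for j
  have \<sigma>_nonneg: "0 \<le> \<sigma> j" for j
    using par by (simp add: \<sigma>_def)
  have dec: "\<phi> (Suc j) \<le> \<phi> j - q * \<sigma> j" for j
    using iteration_decrease[OF it[of j]] par by (auto simp: q_def \<sigma>_def)
  have anti: "decseq \<phi>"
    using dec \<sigma>_nonneg \<open>0 < q\<close> by (intro decseq_SucI) (smt (verit) mult_nonneg_nonneg)
  obtain m R where m: "\<And>u. u \<in> cball a 1 \<Longrightarrow> m \<le> p u"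
    and R: "\<And>u w. u \<in> cball a 1 \<Longrightarrow> w \<in> Orc u \<Longrightarrow> norm w \<le> R"
    using oracle_locally_bounded[OF compact_cball] by metis
  have near: "\<forall>\<^sub>F k in sequentially. x (r k) \<in> cball a 1"
    using tendstoD[OF lim, of 1] by (auto simp: dist_commute elim: eventually_mono)
  \<comment> \<open>Each merit value exceeds a later one, taken on the subsequence, where \<open>p\<close> is at least \<open>m\<close>.\<close>
  have \<phi>_bound: "m \<le> \<phi> j" for j
  proof -
    have "\<forall>\<^sub>F k in sequentially. j \<le> r k"
      using eventually_ge_at_top[of j] by eventually_elim (meson le_trans r seq_suble)
    then obtain k where "x (r k) \<in> cball a 1" "j \<le> r k"
      using eventually_conj[OF near] eventually_happens'[OF sequentially_bot] by blast
    then show ?thesis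
      using m p\<phi>[of "r k"] decseqD[OF anti] by (meson order_trans)
  qed
  have "\<sigma> \<longlonglongrightarrow> 0"
  proof -
    obtain L where L: "\<phi> \<longlonglongrightarrow> L"
      using decseq_convergent[OF anti, of m] \<phi>_bound by blast
    have "(\<lambda>j. (\<phi> j - \<phi> (Suc j)) / q) \<longlonglongrightarrow> (L - L) / q"
      using \<open>0 < q\<close> by (intro tendsto_intros L LIMSEQ_Suc) auto
    then have "(\<lambda>j. (\<phi> j - \<phi> (Suc j)) / q) \<longlonglongrightarrow> 0"
      by simp
    then show ?thesis
    proof (rule tendsto_sandwich[OF _ _ tendsto_const, rotated 2])
      show "\<forall>\<^sub>F j in sequentially. 0 \<le> \<sigma> j"
        using \<sigma>_nonneg by simp
      show "\<forall>\<^sub>F j in sequentially. \<sigma> j \<le> (\<phi> j - \<phi> (Suc j)) / q"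
        using dec \<open>0 < q\<close> by (intro always_eventually allI) (simp add: field_simps)
    qed
  qed
  then have \<sigma>_lim: "(\<lambda>k. \<sigma> (r k)) \<longlonglongrightarrow> 0"
    using LIMSEQ_subseq_LIMSEQ[OF _ r] by (simp add: comp_def)
  \<comment> \<open>The gap per unit of step length between the slope \<open>v \<bullet> d\<close> and the fraction \<open>\<alpha>\<close> of it that the
    line search demands.\<close>
  define e where "e = (1 - \<alpha>) * \<theta> * \<epsilon>"
  have "0 < e"
    using par by (simp add: e_def)
  obtain \<delta> where "0 < \<delta>" and \<delta>: "\<And>u w z. \<lbrakk>u \<in> ball a \<delta>; w \<in> ball a \<delta>; norm z \<le> R\<rbrakk>
      \<Longrightarrow> F w z - F u z \<le> G u z \<bullet> (w - u) + e * norm (w - u)"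
    using F_linearization_uniform[OF \<open>0 < e\<close>, of a R] by metis
  \<comment> \<open>The rejected step is longer than the accepted one by the factor \<open>1 / \<beta>\<close>, hence \<open>\<beta> * \<delta> / 2\<close> below.
    The bound \<open>\<omega> * \<epsilon>\<close> forces a step size below one.\<close>
  have "\<forall>\<^sub>F k in sequentially. dist (x (r k)) a < \<delta> / 2"
    using tendstoD[OF lim, of "\<delta> / 2"] \<open>0 < \<delta>\<close> by simp
  moreover have "\<forall>\<^sub>F k in sequentially. \<sigma> (r k) < \<beta> * \<delta> / 2"
    using order_tendstoD(2)[OF \<sigma>_lim, of "\<beta> * \<delta> / 2"] \<open>0 < \<delta>\<close> par by simp
  moreover have "\<forall>\<^sub>F k in sequentially. \<sigma> (r k) < \<omega> * \<epsilon>"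
    using order_tendstoD(2)[OF \<sigma>_lim, of "\<omega> * \<epsilon>"] par by simp
  ultimately have "\<forall>\<^sub>F k in sequentially. x (r k) \<in> cball a 1 \<and> dist (x (r k)) a < \<delta> / 2 \<and>
      \<sigma> (r k) < \<beta> * \<delta> / 2 \<and> \<sigma> (r k) < \<omega> * \<epsilon>"
    using near by eventually_elim blast
  then obtain k where k: "x (r k) \<in> cball a 1" "dist (x (r k)) a < \<delta> / 2"
      "\<sigma> (r k) < \<beta> * \<delta> / 2" "\<sigma> (r k) < \<omega> * \<epsilon>"
    using eventually_happens'[OF sequentially_bot] by blast
  define j u v w where "j = r k" and "u = x j" and "v = G u (z j)" and "w = z j"
  have orc: "w \<in> Orc u" and "\<epsilon> < norm v" and dir: "admissible_direction \<theta> \<omega> v (d j)"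
    and rejected: "\<And>i. i < \<l> j \<Longrightarrow> \<not> acceptable_step (marginal P) \<alpha> (ereal (\<phi> j)) u v (d j) (\<beta> ^ i) y" for y
    using it[of j] unfolding iteration_def u_def v_def w_def by auto
  have long: "\<omega> * \<epsilon> \<le> norm (d j)" and slope: "v \<bullet> d j \<le> - (\<theta> * \<epsilon> * norm (d j))"
    using admissible_direction_descent[OF dir _ \<open>\<epsilon> < norm v\<close>] par by auto
  have "\<l> j \<noteq> 0"
    using long k(4) by (intro notI) (simp add: \<sigma>_def j_def)
  then obtain i where i: "\<l> j = Suc i"
    using not0_implies_Suc by blast
  define y where "y = u + \<beta> ^ i *\<^sub>R d j"
  have rej: "\<phi> j + \<alpha> * \<beta> ^ i * (v \<bullet> d j) < p y"
    using rejected[of i y] i by (simp add: acceptable_step_real y_def)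
  have step: "norm (y - u) = \<beta> ^ i * norm (d j)"
    using par by (simp add: y_def)
  have "\<sigma> j = \<beta> * norm (y - u)"
    by (simp add: \<sigma>_def i step)
  then have "norm (y - u) < \<delta> / 2"
    using k(3) par by (simp add: j_def)
  moreover have "dist a u < \<delta> / 2"
    using k(2) by (simp add: u_def j_def dist_commute)
  ultimately have "u \<in> ball a \<delta>" "y \<in> ball a \<delta>"
    using dist_triangle[of a y u] \<open>0 < \<delta>\<close> by (auto simp: dist_norm norm_minus_commute)
  moreover have "norm w \<le> R"
    using R orc k(1) by (simp add: u_def j_def)
  ultimately have "F y w - F u w \<le> v \<bullet> (y - u) + e * norm (y - u)"
    using \<delta> by (simp add: v_def w_def)
  moreover have "p y \<le> \<phi> j + (F y w - F u w)"
    using marginal_majorized[OF orc, of y] p\<phi>[of j] by (simp add: u_def)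
  moreover have "v \<bullet> (y - u) = \<beta> ^ i * (v \<bullet> d j)"
    by (simp add: y_def)
  ultimately have "\<alpha> * \<beta> ^ i * (v \<bullet> d j) < \<beta> ^ i * (v \<bullet> d j) + e * (\<beta> ^ i * norm (d j))"
    using rej step by simp
  then have "0 < \<beta> ^ i * ((1 - \<alpha>) * (v \<bullet> d j) + e * norm (d j))"
    by (simp add: algebra_simps)
  then have "0 < (1 - \<alpha>) * (v \<bullet> d j) + e * norm (d j)"
    using par by (simp add: zero_less_mult_iff)
  moreover have "(1 - \<alpha>) * (v \<bullet> d j) \<le> (1 - \<alpha>) * - (\<theta> * \<epsilon> * norm (d j))"
    using slope par by (intro mult_left_mono) auto
  ultimately show False
    by (simp add: e_def algebra_simps)
qed

end

theorem corollary4p5: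
  fixes f :: "real ^ 'n \<Rightarrow> real"
    and c :: "real ^ 'n \<Rightarrow> real ^ 'm"
    and g :: "real ^ 'm \<Rightarrow> ereal"
    and \<mu> :: real
    and yhat :: "real ^ 'm"
    and \<epsilon> \<alpha> \<beta> \<theta> \<omega> \<nu> :: real
    and N :: enat
    and x d :: "nat \<Rightarrow> real ^ 'n"
    and z :: "nat \<Rightarrow> real ^ 'm"
    and \<l> :: "nat \<Rightarrow> nat"
    and \<Phi> :: "nat \<Rightarrow> ereal"
  defines "F \<equiv> smooth_part f c \<mu> yhat"
    and "P \<equiv> penalty f c g \<mu> yhat"
  defines "G \<equiv> (\<lambda>u w. grad (\<lambda>u'. F u' w) u)"
  assumes "continuously_differentiable f"
    and "continuously_differentiable c"
    and "proper g"
    and "lower_semicontinuous g"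
    and "prox_bounded g"
    and "\<bar>INF u. ereal (f u) + g (c u)\<bar> \<noteq> \<infinity>"
    and "0 < \<mu>" and "ereal \<mu> < prox_threshold g"
    and "\<epsilon> > 0"
    and "\<alpha> \<in> {0<..<1}" and "\<beta> \<in> {0<..<1}" and "\<theta> \<in> {0<..<1}"
    and "\<omega> \<in> {0<..1}" and "\<nu> \<in> {0<..1}"
    and "descent_run (marginal P) (oracle_set P) G \<epsilon> \<alpha> \<beta> \<theta> \<omega> \<nu> N x z d \<l> \<Phi>"
    and "N = \<infinity> \<Longrightarrow> \<exists>a. accumulation_point x a"
  shows "\<exists>J. N = enat J \<and>
             returns_at (oracle_set P) G \<epsilon> (x J) (z J) \<and>
             x J \<in> effective_dom (marginal P) \<and> z J \<in> oracle_set P (x J) \<and>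
             upsilon_stationary P \<epsilon> (x J) (z J)"
proof -
  interpret M: penalized_composite f c g \<mu> yhat
    using assms by unfold_locales auto
  note run = \<open>descent_run _ _ _ _ _ _ _ _ _ _ _ _ _ _ _\<close>[unfolded F_def P_def G_def]
  have "N \<noteq> \<infinity>"
  proof
    assume "N = \<infinity>"
    then obtain a where "accumulation_point x a"
      using assms by blast
    moreover have "\<not> accumulation_point x a"
      by (rule M.infinite_run_no_accumulation[OF run[unfolded \<open>N = \<infinity>\<close>]]) (use assms in simp_all)
    ultimately show False
      by contradiction
  qed
  then obtain J where J: "N = enat J"
    by auto
  obtain \<phi> where "\<Phi> J = ereal \<phi>" "M.p (x J) \<le> \<phi>"
    using M.run_merit_bound[OF run, of J] assms J by auto
  then have "\<not> breaks_down (marginal M.P) M.Orc M.G \<epsilon> \<alpha> \<beta> \<theta> \<omega> (x J) (z J) (d J) (\<Phi> J)"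
    using M.no_breakdown assms by simp
  then have ret: "returns_at M.Orc M.G \<epsilon> (x J) (z J)"
    using run J unfolding descent_run_def by blast
  then have "upsilon_stationary M.P \<epsilon> (x J) (z J)"
    by (rule M.returned_point_stationary)
  then show ?thesis
    using J ret unfolding F_def P_def G_def upsilon_stationary_def by auto
qed

end
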